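(* Let $1\le p<\infty$. A closed and bounded set $S\subseteq\mathcal{F}^p(\mathbb{C}^d)$ is compact in $\mathcal{F}^p(\mathbb{C}^d)$ if and only if for every $\epsilon>0$ there exists a compact set $U\subseteq\mathbb{C}^d$ such that $$\sup_{F\in S}\Big(\int_{U^c}|F(z)|^p\,e^{-\frac{\pi}{2}p|z|^2}\,dz\Big)^{1/p}<\epsilon .$$
   Context: The Bargmann-Fock space $\mathcal{F}^p(\mathbb{C}^d)$, $p<\infty$, is the Banach space of entire functions $F$ on $\mathbb{C}^d$ for which the norm $$\|F\|_{\mathcal{F}^p(\mathbb{C}^d)}=\Big(\int_{\mathbb{C}^d}|F(z)|^p\,e^{-\frac{\pi}{2}p|z|^2}\,dz\Big)^{1/p}$$ is finite, where $dz$ is Lebesgue measure on $\mathbb{C}^d\cong\mathbb{R}^{2d}$. $U^c$ denotes the complement of $U$ in $\mathbb{C}^d$. *)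

theory Defs
  imports "HOL-Analysis.Analysis"
begin

text \<open>
  A function on \<open>\<complex>\<^sup>d\<close> is entire if it is complex differentiable everywhere, i.e. Frechet
  differentiable (over the reals) with a complex-linear derivative.  The derivative \<open>D\<close> is
  additive by \<^const>\<open>has_derivative\<close>, so only homogeneity has to be demanded.
\<close>

definition entire :: "(complex ^ 'd \<Rightarrow> complex) \<Rightarrow> bool" where
  "entire F \<longleftrightarrow>
     (\<forall>z. \<exists>D. (F has_derivative D) (at z) \<and> (\<forall>c v. D (c *s v) = c * D v))"

text \<open>The norm on \<^typ>\<open>complex ^ 'd\<close> is the Euclidean one and \<^const>\<open>lborel\<close> is Lebesgue
  measure of real dimension \<open>2d\<close>.\<close>

definition fock_density :: "real \<Rightarrow> (complex ^ 'd \<Rightarrow> complex) \<Rightarrow> complex ^ 'd \<Rightarrow> real" where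
  "fock_density p F z = norm (F z) powr p * exp (- (pi / 2) * p * (norm z)\<^sup>2)"

definition fock_norm_on ::
    "real \<Rightarrow> (complex ^ 'd) set \<Rightarrow> (complex ^ 'd \<Rightarrow> complex) \<Rightarrow> real" where
  "fock_norm_on p A F = (LINT z:A|lborel. fock_density p F z) powr (1 / p)"

abbreviation fock_norm :: "real \<Rightarrow> (complex ^ 'd \<Rightarrow> complex) \<Rightarrow> real" where
  "fock_norm p \<equiv> fock_norm_on p UNIV"

definition fock_space :: "real \<Rightarrow> (complex ^ 'd \<Rightarrow> complex) set" where
  "fock_space p = {F. entire F \<and> integrable lborel (fock_density p F)}"

definition fock_dist ::
    "real \<Rightarrow> (complex ^ 'd \<Rightarrow> complex) \<Rightarrow> (complex ^ 'd \<Rightarrow> complex) \<Rightarrow> real" where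
  "fock_dist p F G = fock_norm p (\<lambda>z. F z - G z)"

abbreviation fock_topology :: "real \<Rightarrow> (complex ^ 'd \<Rightarrow> complex) topology" where
  "fock_topology p \<equiv> Metric_space.mtopology (fock_space p) (fock_dist p)"

lemma entire_diff:
  assumes "entire F" "entire G"
  shows "entire (\<lambda>z. F z - G z)"
  unfolding entire_def
proof
  fix z
  obtain D where D: "(F has_derivative D) (at z)" "\<forall>c v. D (c *s v) = c * D v"
    using assms(1) unfolding entire_def by blast
  obtain E where E: "(G has_derivative E) (at z)" "\<forall>c v. E (c *s v) = c * E v"
    using assms(2) unfolding entire_def by blast
  have "((\<lambda>z. F z - G z) has_derivative (\<lambda>v. D v - E v)) (at z)"
    by (intro has_derivative_diff D E)
  moreover have "\<forall>c v. D (c *s v) - E (c *s v) = c * (D v - E v)"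
    using D(2) E(2) by (simp add: right_diff_distrib)
  ultimately show "\<exists>D'. ((\<lambda>z. F z - G z) has_derivative D') (at z)
      \<and> (\<forall>c v. D' (c *s v) = c * D' v)"
    by (intro exI[of _ "\<lambda>v. D v - E v"]) simp
qed

lemma entire_continuous: "entire F \<Longrightarrow> continuous_on UNIV F"
  unfolding entire_def continuous_on_eq_continuous_at[OF open_UNIV]
  using has_derivative_continuous by blast

lemma fock_density_nonneg: "0 \<le> fock_density p F z"
  by (simp add: fock_density_def)

lemma fock_density_measurable:
  assumes "entire F"
  shows "fock_density p F \<in> borel_measurable lborel"
proof -
  have [measurable]: "F \<in> borel_measurable borel"
    using entire_continuous[OF assms] by (rule borel_measurable_continuous_onI)
  show ?thesis
    unfolding fock_density_def by measurable
qed

lemma fock_density_diff_le: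
  fixes z :: "complex ^ 'd"
  assumes p: "1 \<le> p" and a: "0 < a" and b: "0 < b"
  shows "fock_density p (\<lambda>z. F z - G z) z / (a + b) powr p
    \<le> a / (a + b) * (fock_density p F z / a powr p)
      + b / (a + b) * (fock_density p G z / b powr p)"
proof -
  let ?s = "a / (a + b)" and ?t = "b / (a + b)"
  define x where "x = norm (F z) / a"
  define y where "y = norm (G z) / b"
  have st: "0 < ?s" "?s \<le> 1" "0 < ?t" "?t \<le> 1" "?s + ?t = 1"
    using a b by (auto simp flip: add_divide_distrib)
  have xy: "0 \<le> x" "0 \<le> y"
    using a b by (auto simp: x_def y_def)
  have scale: "(c * u) powr p \<le> c * u powr p" if "0 < c" "c \<le> 1" "0 \<le> u" for c u :: real
  proof -
    have "c powr p \<le> c powr 1"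
      using that p by (intro powr_mono') auto
    then show ?thesis
      using that by (simp add: powr_mult mult_right_mono)
  qed
  have conv: "(?s * x + ?t * y) powr p \<le> ?s * x powr p + ?t * y powr p"
  proof -
    consider "x = 0" | "y = 0" | "0 < x" "0 < y"
      using xy by linarith
    then show ?thesis
    proof cases
      case 1
      then show ?thesis using scale[OF st(3,4) xy(2)] p by simp
    next
      case 2
      then show ?thesis using scale[OF st(1,2) xy(1)] p by simp
    next
      case 3
      show ?thesis
        using convex_onD[OF powr_convex[OF p], of ?t x y] 3 st
        by (metis add_diff_cancel_right' greaterThan_iff less_eq_real_def real_scaleR_def)
    qed
  qed
  have "norm (F z - G z) / (a + b) \<le> ?s * x + ?t * y"
    using a b norm_triangle_ineq4[of "F z" "G z"]
    by (simp add: x_def y_def divide_right_mono flip: add_divide_distrib)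
  then have "(norm (F z - G z) / (a + b)) powr p \<le> (?s * x + ?t * y) powr p"
    using a b p by (intro powr_mono2) auto
  also note conv
  finally have "norm (F z - G z) powr p / (a + b) powr p
      \<le> ?s * (norm (F z) powr p / a powr p) + ?t * (norm (G z) powr p / b powr p)"
    using a b by (simp add: x_def y_def powr_divide)
  from mult_right_mono[OF this, of "exp (- (pi / 2) * p * (norm z)\<^sup>2)"]
  show ?thesis
    by (simp add: fock_density_def algebra_simps)
qed

lemma fock_space_diff:
  assumes p: "1 \<le> p" and F: "F \<in> fock_space p" and G: "G \<in> fock_space p"
  shows "(\<lambda>z. F z - G z) \<in> fock_space p"
proof -
  have ent: "entire (\<lambda>z. F z - G z)"
    using F G by (simp add: fock_space_def entire_diff)
  have "integrable lborel (\<lambda>z. fock_density p (\<lambda>z. F z - G z) z / 2 powr p)"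
  proof (rule Bochner_Integration.integrable_bound)
    show "integrable lborel (\<lambda>z. (fock_density p F z + fock_density p G z) / 2)"
      using F G by (simp add: fock_space_def)
    show "(\<lambda>z. fock_density p (\<lambda>z. F z - G z) z / 2 powr p) \<in> borel_measurable lborel"
      using fock_density_measurable[OF ent] by simp
    show "AE z in lborel. norm (fock_density p (\<lambda>z. F z - G z) z / 2 powr p)
        \<le> norm ((fock_density p F z + fock_density p G z) / 2)"
      using fock_density_diff_le[OF p, of 1 1 F G]
      by (simp add: fock_density_nonneg add_divide_distrib)
  qed
  from integrable_mult_left[OF this, of "2 powr p"]
  have "integrable lborel (fock_density p (\<lambda>z. F z - G z))"
    by simp
  then show ?thesis
    using ent by (simp add: fock_space_def)
qed

lemma fock_norm_eq: "fock_norm p F = (LINT z|lborel. fock_density p F z) powr (1 / p)"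
  by (simp add: fock_norm_on_def set_lebesgue_integral_def)

lemma fock_norm_diff_le:
  assumes p: "1 \<le> p" and F: "F \<in> fock_space p" and G: "G \<in> fock_space p"
  shows "fock_norm p (\<lambda>z. F z - G z) \<le> fock_norm p F + fock_norm p G"
proof (rule field_le_epsilon)
  fix e :: real
  assume e: "0 < e"
  let ?I = "\<lambda>F. LINT z|lborel. fock_density p F z"
  define a where "a = fock_norm p F + e / 2"
  define b where "b = fock_norm p G + e / 2"
  have nonneg: "0 \<le> ?I F" for F
    by (intro integral_nonneg_AE) (simp add: fock_density_nonneg)
  have ab: "0 < a" "0 < b"
    using e by (simp_all add: a_def b_def fock_norm_eq add_nonneg_pos)
  have bound: "?I H / c powr p \<le> 1" if "0 < c" "fock_norm p H \<le> c" for H c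
  proof -
    have "?I H = fock_norm p H powr p"
      using nonneg[of H] p by (simp add: fock_norm_eq powr_powr)
    also have "\<dots> \<le> c powr p"
      using that p by (intro powr_mono2) (auto simp: fock_norm_eq)
    finally show ?thesis
      using that by simp
  qed
  have int: "integrable lborel (fock_density p F)" "integrable lborel (fock_density p G)"
    "integrable lborel (fock_density p (\<lambda>z. F z - G z))"
    using F G fock_space_diff[OF p F G] by (simp_all add: fock_space_def)
  have "?I (\<lambda>z. F z - G z) / (a + b) powr p
      = (LINT z|lborel. fock_density p (\<lambda>z. F z - G z) z / (a + b) powr p)"
    by simp
  also have "\<dots> \<le> (LINT z|lborel. a / (a + b) * (fock_density p F z / a powr p)
      + b / (a + b) * (fock_density p G z / b powr p))"
    using int fock_density_diff_le[OF p ab, of F G]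
    by (intro integral_mono) auto
  also have "\<dots> = a / (a + b) * (?I F / a powr p) + b / (a + b) * (?I G / b powr p)"
    using int by (subst Bochner_Integration.integral_add) auto
  also have "\<dots> \<le> a / (a + b) * 1 + b / (a + b) * 1"
    using ab e bound[of a F] bound[of b G]
    by (intro add_mono mult_left_mono) (auto simp: a_def b_def)
  also have "\<dots> = 1"
    using ab by (simp flip: add_divide_distrib)
  finally have "?I (\<lambda>z. F z - G z) \<le> (a + b) powr p"
    using ab by (simp add: field_simps)
  then have "fock_norm p (\<lambda>z. F z - G z) \<le> ((a + b) powr p) powr (1 / p)"
    unfolding fock_norm_eq using p nonneg by (intro powr_mono2) auto
  also have "\<dots> = a + b"
    using p ab by (simp add: powr_powr)
  finally show "fock_norm p (\<lambda>z. F z - G z) \<le> fock_norm p F + fock_norm p G + e"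
    by (simp add: a_def b_def)
qed

lemma fock_norm_eq_0_imp:
  assumes F: "F \<in> fock_space p" and 0: "fock_norm p F = 0"
  shows "F z = 0"
proof (rule ccontr)
  assume z: "F z \<noteq> 0"
  have ent: "entire F" and int: "integrable lborel (fock_density p F)"
    using F by (simp_all add: fock_space_def)
  have "(LINT z|lborel. fock_density p F z) = 0"
    using 0 by (simp add: fock_norm_eq)
  then have "AE z in lborel. fock_density p F z = 0"
    using integral_nonneg_eq_0_iff_AE[OF int] by (simp add: fock_density_nonneg)
  then have ae: "AE z in lborel. z \<notin> {z. F z \<noteq> 0}"
    by (rule AE_mp) (simp add: fock_density_def)
  have op: "open {z. F z \<noteq> 0}"
    using entire_continuous[OF ent] by (intro open_Collect_neq continuous_intros) auto
  then have "{z. F z \<noteq> 0} \<in> null_sets lborel"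
    using ae by (subst AE_iff_null_sets) auto
  then have "negligible {z. F z \<noteq> 0}"
    by (simp add: negligible_iff_null_sets null_sets_completionI)
  with op z show False
    using open_not_negligible by blast
qed

lemma Metric_space_fock:
  assumes p: "1 \<le> p"
  shows "Metric_space (fock_space p :: (complex ^ 'd \<Rightarrow> complex) set) (fock_dist p)"
proof
  fix F G H :: "complex ^ 'd \<Rightarrow> complex"
  show "0 \<le> fock_dist p F G"
    by (simp add: fock_dist_def fock_norm_eq)
  have sym: "fock_dist p F G = fock_dist p G F" for F G :: "complex ^ 'd \<Rightarrow> complex"
    by (simp add: fock_dist_def fock_norm_eq fock_density_def norm_minus_commute)
  show "fock_dist p F G = fock_dist p G F"
    by (rule sym)
  assume F: "F \<in> fock_space p" and G: "G \<in> fock_space p"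
  show "fock_dist p F G = 0 \<longleftrightarrow> F = G"
  proof
    assume "fock_dist p F G = 0"
    then show "F = G"
      using fock_norm_eq_0_imp[OF fock_space_diff[OF p F G]]
      by (auto simp: fock_dist_def)
  next
    assume "F = G"
    then show "fock_dist p F G = 0"
      using p by (simp add: fock_dist_def fock_norm_eq fock_density_def)
  qed
  assume H: "H \<in> fock_space p"
  show "fock_dist p F H \<le> fock_dist p F G + fock_dist p G H"
    using fock_norm_diff_le[OF p fock_space_diff[OF p F G] fock_space_diff[OF p H G]]
    by (simp add: sym[of G H]) (simp add: fock_dist_def)
qed

end

theory Submission
  imports Defs "HOL-Complex_Analysis.Great_Picard"
begin

text \<open>
  This is the Riesz-Kolmogorov compactness criterion for Fock spaces.  In \<open>L\<^sup>p\<close> one needs tightness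
  together with equicontinuity in the mean; for entire functions a norm bound already forces local
  equicontinuity, so tightness alone decides.

  Tightness is sufficient because a norm-bounded family of entire functions is normal.  The mean
  value inequality over balls (\<open>entire_norm_le_ball_mean\<close>) bounds point values by the norm, locally
  uniformly (\<open>fock_space_pointwise_bound\<close>), and Montel's theorem (\<open>entire_Montel\<close>) then gives every
  sequence in \<open>S\<close> a subsequence converging locally uniformly to an entire function.  By Fatou's lemma
  the limit lies in the space and has tails no larger than those of the sequence.  Locally uniform
  convergence controls the distance to the limit on a large compact set and tightness controls it
  elsewhere, so the subsequence converges in norm (\<open>fock_converges_of_tight\<close>).

  Tightness is necessary because a compact set is totally bounded: a single function has vanishing
  tails, hence so do finitely many, and an \<open>\<eta>\<close>-net transfers the bound to the whole set
  (\<open>fock_compact_imp_tight\<close>).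

  The several-variable facts are reduced to one variable by restriction to complex lines.  In place of
  iterated integrals over the coordinates, the mean value inequality averages over all directions
  in a ball, which only needs that multiplication by a unimodular scalar preserves Lebesgue measure;
  this holds for every linear isometry (\<open>nn_integral_lborel_linear_isometry\<close>).
\<close>

section \<open>Linear isometries preserve Lebesgue measure\<close>

lemma nn_integral_lborel_translate:
  fixes f :: "'a::euclidean_space \<Rightarrow> ennreal"
  assumes [measurable]: "f \<in> borel_measurable borel"
  shows "(\<integral>\<^sup>+x. f (x + c) \<partial>lborel) = (\<integral>\<^sup>+x. f x \<partial>lborel)"
proof -
  have "(\<integral>\<^sup>+x. f x \<partial>lborel) = (\<integral>\<^sup>+x. f x \<partial>distr lborel borel ((+) c))"
    by (simp add: lborel_distr_plus)
  also have "\<dots> = (\<integral>\<^sup>+x. f (x + c) \<partial>lborel)"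
    by (subst nn_integral_distr) (auto simp: add.commute)
  finally show ?thesis ..
qed

text \<open>
  This is the uniqueness argument for Haar measure, specialised to one map.  For an auxiliary unit
  ball, the product of \<open>\<integral> f (T y) dy\<close> and the volume of the ball is a double integral.
  Translating first in \<open>y\<close> and then in \<open>x\<close> moves \<open>T\<close> from the argument of \<open>f\<close> into the indicator
  of the ball, where it disappears because \<open>T\<close> maps balls to balls of the same radius.
\<close>

lemma nn_integral_lborel_linear_isometry:
  fixes f :: "'a::euclidean_space \<Rightarrow> ennreal" and T :: "'a \<Rightarrow> 'a"
  assumes f [measurable]: "f \<in> borel_measurable borel"
    and T: "linear T" and iso: "\<And>x. norm (T x) = norm x"
  shows "(\<integral>\<^sup>+x. f (T x) \<partial>lborel) = (\<integral>\<^sup>+x. f x \<partial>lborel)"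
proof -
  let ?b = "indicator (ball 0 1) :: 'a \<Rightarrow> ennreal"
  define \<beta> where "\<beta> = emeasure lborel (ball (0::'a) 1)"
  have \<beta>: "\<beta> \<noteq> 0" "\<beta> \<noteq> \<infinity>"
    using open_not_negligible[of "ball (0::'a) 1"] emeasure_lborel_ball_finite[of "0::'a" 1]
    unfolding \<beta>_def
    by (auto simp: negligible_iff_null_sets null_sets_def)
  have [measurable]: "?b \<in> borel_measurable borel"
    by (intro borel_measurable_indicator borel_open open_ball)
  have [measurable]: "T \<in> borel_measurable borel"
    using T by (simp add: borel_measurable_continuous_onI linear_continuous_on linear_conv_bounded_linear)
  have "inj T"
    using T iso by (metis linear_injective_0 norm_eq_zero)
  then have "surj T"
    using T by (simp add: linear_injective_imp_surjective)
  then obtain S where S: "\<And>x. T (S x) = x"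
    by (metis surjD)
  \<comment> \<open>Since \<open>T\<close> is onto, a translation of its values comes from a translation of its argument.\<close>
  have shift: "(\<integral>\<^sup>+y. f (T y) \<partial>lborel) = (\<integral>\<^sup>+y. f (T y + x) \<partial>lborel)" for x
    using nn_integral_lborel_translate[of "\<lambda>y. f (T y)" "S x"] T by (simp add: linear_add S)
  have fibre: "(\<integral>\<^sup>+y. ?b (x - T y) \<partial>lborel) = \<beta>" for x
  proof -
    have "norm (x - T y) = norm (S x - y)" for y
      using iso[of "S x - y"] T by (simp add: linear_diff S)
    then have "?b (x - T y) = ?b (y + - S x)" for y
      by (simp add: indicator_def norm_minus_commute[of y])
    then show ?thesis
      using nn_integral_lborel_translate[of ?b "- S x"] by (simp add: \<beta>_def)
  qed
  have "(\<integral>\<^sup>+y. f (T y) \<partial>lborel) * \<beta> = (\<integral>\<^sup>+x. (\<integral>\<^sup>+y. f (T y) \<partial>lborel) * ?b x \<partial>lborel)"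
    by (simp add: \<beta>_def nn_integral_cmult)
  also have "\<dots> = (\<integral>\<^sup>+x. \<integral>\<^sup>+y. f (T y + x) * ?b x \<partial>lborel \<partial>lborel)"
  proof (rule nn_integral_cong)
    fix x
    show "(\<integral>\<^sup>+y. f (T y) \<partial>lborel) * ?b x = (\<integral>\<^sup>+y. f (T y + x) * ?b x \<partial>lborel)"
      by (subst shift[of x]) (rule nn_integral_multc[symmetric], measurable)
  qed
  also have "\<dots> = (\<integral>\<^sup>+y. \<integral>\<^sup>+x. f (T y + x) * ?b x \<partial>lborel \<partial>lborel)"
    by (rule lborel_pair.Fubini') measurable
  also have "\<dots> = (\<integral>\<^sup>+y. \<integral>\<^sup>+x. f x * ?b (x - T y) \<partial>lborel \<partial>lborel)"
  proof (rule nn_integral_cong)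
    fix y
    show "(\<integral>\<^sup>+x. f (T y + x) * ?b x \<partial>lborel) = (\<integral>\<^sup>+x. f x * ?b (x - T y) \<partial>lborel)"
      using nn_integral_lborel_translate[of "\<lambda>x. f x * ?b (x - T y)" "T y"]
      by (simp add: add.commute)
  qed
  also have "\<dots> = (\<integral>\<^sup>+x. \<integral>\<^sup>+y. f x * ?b (x - T y) \<partial>lborel \<partial>lborel)"
    by (rule lborel_pair.Fubini') measurable
  also have "\<dots> = (\<integral>\<^sup>+x. f x \<partial>lborel) * \<beta>"
    by (subst nn_integral_cmult) (auto simp: fibre nn_integral_multc)
  finally show ?thesis
    using \<beta> by (simp add: mult.commute[of _ \<beta>] ennreal_mult_cancel_left)
qed

section \<open>Entire functions on complex lines\<close>

lemma entire_has_derivative: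
  assumes "entire F"
  shows "(F has_derivative frechet_derivative F (at z)) (at z)"
  using assms unfolding entire_def by (metis differentiableI frechet_derivative_works)

lemma entire_frechet_derivative_scale:
  assumes "entire F"
  shows "frechet_derivative F (at z) (c *s v) = c * frechet_derivative F (at z) v"
  using assms unfolding entire_def by (metis frechet_derivative_at)

text \<open>
  Restricting to complex lines makes one-variable complex analysis available: complex linearity of
  the derivative is exactly what turns the chain rule into a complex derivative.
\<close>

lemma entire_slice_has_field_derivative:
  assumes "entire F"
  shows "((\<lambda>t. F (z + t *s v)) has_field_derivative frechet_derivative F (at (z + t *s v)) v) (at t)"
proof -
  have "linear (\<lambda>h::complex. h *s v)"
    by (rule linearI) (simp_all add: vec_eq_iff algebra_simps)
  then have "bounded_linear (\<lambda>h::complex. h *s v)"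
    by (simp add: linear_conv_bounded_linear)
  then have "((\<lambda>t. z + t *s v) has_derivative (\<lambda>h. h *s v)) (at t)"
    by (auto intro!: derivative_eq_intros bounded_linear_imp_has_derivative)
  from has_derivative_compose[OF this entire_has_derivative[OF assms]]
  show ?thesis
    by (simp add: has_field_derivative_def entire_frechet_derivative_scale[OF assms] mult.commute)
       (simp add: mult.commute[of _ "frechet_derivative _ _ _"])
qed

lemma continuous_on_vector_scalar_mult:
  fixes v :: "'a::topological_space \<Rightarrow> complex ^ 'd"
  assumes "continuous_on A c" "continuous_on A v"
  shows "continuous_on A (\<lambda>x. c x *s v x)"
  unfolding vector_scalar_mult_def using assms by (intro continuous_intros)

lemma norm_vector_scalar_mult: "norm (c *s v) = cmod c * norm (v :: complex ^ 'd)"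
  by (simp add: norm_vec_def norm_mult L2_set_right_distrib)

section \<open>The mean value inequality\<close>

lemma entire_circle_mean:
  assumes "entire F"
  shows "((\<lambda>s::real. F (z + exp (2 * of_real pi * \<i> * of_real s) *s v)) has_integral F z) {0..1}"
proof -
  define f where "f t = F (z + t *s v)" for t
  have cancel: "inverse (2 * of_real pi * \<i>) * (2 * of_real pi * \<i> * w) = w" for w :: complex
    by (simp add: field_simps)
  have "f holomorphic_on cball 0 1"
    unfolding f_def using entire_slice_has_field_derivative[OF assms]
    by (meson field_differentiable_def field_differentiable_at_within holomorphic_onI)
  from Cauchy_integral_circlepath_simple[OF this, of 0]
  have "((\<lambda>s. f (circlepath 0 1 s) / circlepath 0 1 s * vector_derivative (circlepath 0 1) (at s))
      has_integral 2 * of_real pi * \<i> * f 0) {0..1}"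
    by (simp add: has_contour_integral)
  then have "((\<lambda>s. 2 * of_real pi * \<i> * f (exp (2 * of_real pi * \<i> * of_real s)))
      has_integral 2 * of_real pi * \<i> * f 0) {0..1}"
    by (rule has_integral_eq[rotated]) (simp add: vector_derivative_circlepath, simp add: circlepath)
  from has_integral_mult_right[OF this, of "inverse (2 * of_real pi * \<i>)"]
  have "((\<lambda>s. f (exp (2 * of_real pi * \<i> * of_real s))) has_integral f 0) {0..1}"
    unfolding cancel .
  then show ?thesis
    by (simp add: f_def)
qed

lemma entire_norm_le_circle_mean:
  assumes "entire F"
  shows "ennreal (norm (F z)) \<le>
    (\<integral>\<^sup>+s. ennreal (norm (F (z + exp (2 * of_real pi * \<i> * of_real s) *s v))) * indicator {0..1} s
      \<partial>(lborel :: real measure))"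
proof -
  let ?f = "\<lambda>s::real. F (z + exp (2 * of_real pi * \<i> * of_real s) *s v)"
  have cont: "continuous_on {0..1} ?f"
    by (intro continuous_on_compose2[OF entire_continuous[OF assms]] continuous_intros
        continuous_on_vector_scalar_mult) auto
  then have int: "(\<lambda>s. norm (?f s)) integrable_on {0..1}"
    by (intro integrable_continuous_real continuous_on_norm)
  have "norm (F z) = norm (integral {0..1} ?f)"
    using entire_circle_mean[OF assms, of z v] by (simp add: integral_unique)
  also have "\<dots> \<le> integral {0..1} (\<lambda>s. norm (?f s))"
    using int by (intro integral_norm_bound_integral integrable_continuous_real[OF cont]) auto
  finally have "ennreal (norm (F z)) \<le> ennreal (integral {0..1} (\<lambda>s. norm (?f s)))"
    by (rule ennreal_leI)
  also have "\<dots> = (\<integral>\<^sup>+s. ennreal (norm (?f s)) * indicator {0..1} s \<partial>lborel)"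
    using int by (intro nn_integral_has_integral_lebesgue'[symmetric]) (auto simp: has_integral_integral)
  finally show ?thesis .
qed

text \<open>
  Averaging the circle means over \<open>v\<close> in the unit ball and exchanging the integrals leaves, for each
  angle, the integral of \<open>\<bar>F\<bar>\<close> over the ball after a rotation by a unimodular scalar.  That rotation
  is a linear isometry of the underlying real space, so the angle drops out.  This gives the
  mean value inequality in \<open>d\<close> variables without iterating over coordinates.
\<close>

lemma entire_norm_le_ball_mean:
  fixes F :: "complex ^ 'd \<Rightarrow> complex"
  assumes F: "entire F"
  shows "ennreal (norm (F z)) * emeasure lborel (ball (0 :: complex ^ 'd) 1)
    \<le> (\<integral>\<^sup>+w. ennreal (norm (F w)) * indicator (ball z 1) w \<partial>lborel)"
proof -
  let ?b = "indicator (ball 0 1) :: complex ^ 'd \<Rightarrow> ennreal"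
  let ?e = "\<lambda>s::real. exp (2 * of_real pi * \<i> * of_real s)"
  let ?i = "indicator {0..1} :: real \<Rightarrow> ennreal"
  let ?I = "\<integral>\<^sup>+v. ennreal (norm (F (z + v))) * ?b v \<partial>lborel"
  have [measurable]: "F \<in> borel_measurable borel"
    using entire_continuous[OF F] by (rule borel_measurable_continuous_onI)
  have [measurable]: "?b \<in> borel_measurable borel"
    by (intro borel_measurable_indicator borel_open open_ball)
  have "continuous_on UNIV (\<lambda>x. ?e (fst x) *s (snd x :: complex ^ 'd))"
    by (intro continuous_on_vector_scalar_mult continuous_intros)
  then have [measurable]: "(\<lambda>x. ?e (fst x) *s (snd x :: complex ^ 'd)) \<in> borel_measurable (borel \<Otimes>\<^sub>M borel)"
    unfolding borel_prod by (rule borel_measurable_continuous_onI)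
  have "continuous_on UNIV (\<lambda>s. ?e s *s v)" for v :: "complex ^ 'd"
    by (intro continuous_on_vector_scalar_mult continuous_intros)
  then have [measurable]: "(\<lambda>s. ?e s *s v) \<in> borel_measurable borel" for v :: "complex ^ 'd"
    by (rule borel_measurable_continuous_onI)
  have "continuous_on UNIV (\<lambda>v :: complex ^ 'd. ?e s *s v)" for s
    by (intro continuous_on_vector_scalar_mult continuous_intros)
  then have [measurable]: "(*s) (?e s) \<in> borel_measurable (borel :: (complex ^ 'd) measure)" for s
    by (rule borel_measurable_continuous_onI)
  have rot: "(\<integral>\<^sup>+v. ennreal (norm (F (z + ?e s *s v))) * ?b v \<partial>lborel) = ?I" for s
  proof -
    have lin: "linear (\<lambda>v :: complex ^ 'd. ?e s *s v)"
      by (rule linearI) (simp_all add: vec_eq_iff algebra_simps)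
    have iso: "norm (?e s *s v) = norm v" for v :: "complex ^ 'd"
      by (simp add: norm_vector_scalar_mult)
    have b: "?b (?e s *s v) = ?b v" for v
      by (simp add: indicator_def iso)
    have "(\<lambda>v. ennreal (norm (F (z + v))) * ?b v) \<in> borel_measurable borel"
      by measurable
    from nn_integral_lborel_linear_isometry[OF this lin iso] show ?thesis
      by (simp add: b)
  qed
  have "ennreal (norm (F z)) * emeasure lborel (ball (0 :: complex ^ 'd) 1)
      = (\<integral>\<^sup>+v. ennreal (norm (F z)) * ?b v \<partial>lborel)"
    by (simp add: nn_integral_cmult)
  also have "\<dots> \<le> (\<integral>\<^sup>+v. (\<integral>\<^sup>+s. ennreal (norm (F (z + ?e s *s v))) * ?i s \<partial>lborel) * ?b v \<partial>lborel)"
    by (intro nn_integral_mono mult_right_mono entire_norm_le_circle_mean F) simp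
  also have "\<dots> = (\<integral>\<^sup>+v. \<integral>\<^sup>+s. ennreal (norm (F (z + ?e s *s v))) * ?i s * ?b v \<partial>lborel \<partial>lborel)"
    by (subst nn_integral_multc) auto
  also have "\<dots> = (\<integral>\<^sup>+s. \<integral>\<^sup>+v. ennreal (norm (F (z + ?e s *s v))) * ?i s * ?b v \<partial>lborel \<partial>lborel)"
    by (rule lborel_pair.Fubini') measurable
  also have "\<dots> = (\<integral>\<^sup>+s. (\<integral>\<^sup>+v. ennreal (norm (F (z + ?e s *s v))) * ?b v \<partial>lborel) * ?i s \<partial>lborel)"
  proof (rule nn_integral_cong)
    fix s
    have "(\<integral>\<^sup>+v. ennreal (norm (F (z + ?e s *s v))) * ?b v * ?i s \<partial>lborel)
        = (\<integral>\<^sup>+v. ennreal (norm (F (z + ?e s *s v))) * ?b v \<partial>lborel) * ?i s"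
      by (rule nn_integral_multc) measurable
    then show "(\<integral>\<^sup>+v. ennreal (norm (F (z + ?e s *s v))) * ?i s * ?b v \<partial>lborel)
        = (\<integral>\<^sup>+v. ennreal (norm (F (z + ?e s *s v))) * ?b v \<partial>lborel) * ?i s"
      by (simp only: mult.assoc mult.commute[of "?i s"])
  qed
  also have "\<dots> = ?I"
    by (simp only: rot, subst nn_integral_cmult) (auto simp: \<open>?b \<in> borel_measurable borel\<close>)
  also have "\<dots> = (\<integral>\<^sup>+w. ennreal (norm (F w)) * ?b (w - z) \<partial>lborel)"
    using nn_integral_lborel_translate[of "\<lambda>w. ennreal (norm (F w)) * ?b (w - z)" z]
    by (simp add: add.commute)
  also have "\<dots> = (\<integral>\<^sup>+w. ennreal (norm (F w)) * indicator (ball z 1) w \<partial>lborel)"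
    by (intro nn_integral_cong) (auto simp: indicator_def dist_norm norm_minus_commute)
  finally show ?thesis .
qed

section \<open>The Cauchy estimate and limits of entire functions\<close>

text \<open>
  Apply the one-variable Cauchy inequality on the unit disc of the complex line through \<open>z\<close> in the
  direction of \<open>v\<close>.  Since only complex lines are used, the constant does not depend on the
  dimension.
\<close>

lemma entire_Cauchy_estimate:
  assumes F: "entire F" and M: "\<And>w. norm (w - z) \<le> 1 \<Longrightarrow> norm (F w) \<le> M"
  shows "norm (frechet_derivative F (at z) v) \<le> M * norm v"
proof (cases "v = 0")
  case True
  then show ?thesis
    using linear_0[OF has_derivative_linear[OF entire_has_derivative[OF F]]] by simp
next
  case False
  define u where "u = inverse (norm v) *\<^sub>R v"
  define f where "f t = F (z + t *s u)" for t
  have u: "norm u = 1" "v = norm v *\<^sub>R u"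
    using False by (simp_all add: u_def)
  have f': "(f has_field_derivative frechet_derivative F (at (z + t *s u)) u) (at t)" for t
    unfolding f_def by (rule entire_slice_has_field_derivative[OF F])
  then have hol: "f holomorphic_on A" for A
    by (meson field_differentiable_def field_differentiable_at_within holomorphic_onI)
  have "norm ((deriv ^^ 1) f 0) \<le> fact 1 * M / 1 ^ 1"
    using u by (intro Cauchy_inequality hol holomorphic_on_imp_continuous_on)
      (auto simp: f_def norm_vector_scalar_mult intro!: M)
  then have "norm (frechet_derivative F (at z) u) \<le> M"
    using DERIV_imp_deriv[OF f'[of 0]] by simp
  moreover have "frechet_derivative F (at z) v = norm v *\<^sub>R frechet_derivative F (at z) u"
    using u(2) linear_scale[OF has_derivative_linear[OF entire_has_derivative[OF F]]] by metis
  ultimately show ?thesis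
    by (simp add: mult.commute[of M] mult_left_mono)
qed

lemma entire_Lipschitz:
  fixes F :: "complex ^ 'd \<Rightarrow> complex"
  assumes F: "entire F" and M: "\<And>w. norm w \<le> R + 1 \<Longrightarrow> norm (F w) \<le> M"
    and "norm x \<le> R" "norm y \<le> R"
  shows "norm (F x - F y) \<le> M * norm (x - y)"
proof (rule differentiable_bound)
  show "convex (cball (0 :: complex ^ 'd) R)" "x \<in> cball 0 R" "y \<in> cball 0 R"
    using assms by auto
  fix z :: "complex ^ 'd" assume z: "z \<in> cball 0 R"
  show "(F has_derivative frechet_derivative F (at z)) (at z within cball 0 R)"
    using entire_has_derivative[OF F] by (rule has_derivative_at_withinI)
  have "norm (F w) \<le> M" if "norm (w - z) \<le> 1" for w
    using that z norm_triangle_sub[of w z] by (intro M) auto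
  then show "onorm (frechet_derivative F (at z)) \<le> M"
    by (intro onorm_le entire_Cauchy_estimate F)
qed

text \<open>
  The Cauchy estimate, applied to \<open>f n - f m\<close> on a ball of radius one larger, shows that the
  derivatives are uniformly Cauchy on bounded sets.  Hence the limit is differentiable and its
  derivative is the limit of the derivatives, which inherits complex homogeneity.
\<close>

lemma entire_uniform_limit:
  fixes f :: "nat \<Rightarrow> complex ^ 'd \<Rightarrow> complex"
  assumes f: "\<And>n. entire (f n)"
    and lim: "\<And>R. uniform_limit (cball 0 R) f g sequentially"
  shows "entire g"
  unfolding entire_def
proof
  fix z :: "complex ^ 'd"
  \<comment> \<open>Bounded, so that uniform convergence on closed balls covers a unit neighbourhood of it.\<close>
  define B where "B = ball (0 :: complex ^ 'd) (norm z + 1)"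
  let ?D = "\<lambda>n x. frechet_derivative (f n) (at x)"
  have Cauchy_D: "\<exists>N. \<forall>n\<ge>N. \<forall>m\<ge>N. \<forall>x\<in>B. \<forall>h. norm (?D n x h - ?D m x h) \<le> e * norm h"
    if "e > 0" for e
  proof -
    obtain N where N: "\<And>n x. n \<ge> N \<Longrightarrow> norm x \<le> norm z + 2 \<Longrightarrow> dist (f n x) (g x) < e / 2"
      using lim[of "norm z + 2"] \<open>e > 0\<close>
      unfolding uniform_limit_iff eventually_sequentially by (metis half_gt_zero mem_cball_0)
    have "norm (?D n x h - ?D m x h) \<le> e * norm h" if "n \<ge> N" "m \<ge> N" "x \<in> B" for n m x h
    proof -
      have "((\<lambda>x. f n x - f m x) has_derivative (\<lambda>h. ?D n x h - ?D m x h)) (at x)"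
        by (intro has_derivative_diff entire_has_derivative f)
      from frechet_derivative_at[OF this]
      have "?D n x h - ?D m x h = frechet_derivative (\<lambda>x. f n x - f m x) (at x) h"
        by (rule fun_cong)
      moreover have "norm (f n w - f m w) \<le> e" if w: "norm (w - x) \<le> 1" for w
      proof -
        have "norm w \<le> norm z + 2"
          using w \<open>x \<in> B\<close> norm_triangle_sub[of w x] by (simp add: B_def)
        then have "dist (f n w) (g w) < e / 2" "dist (f m w) (g w) < e / 2"
          using N \<open>n \<ge> N\<close> \<open>m \<ge> N\<close> by auto
        then show ?thesis
          using dist_triangle_half_l by (metis dist_norm less_imp_le)
      qed
      ultimately show ?thesis
        by (simp add: entire_Cauchy_estimate entire_diff f)
    qed
    then show ?thesis
      by blast
  qed
  define D where "D x h = lim (\<lambda>n. ?D n x h)" for x h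
  have D: "(\<lambda>n. ?D n x h) \<longlonglongrightarrow> D x h" if "x \<in> B" for x h
  proof -
    have "Cauchy (\<lambda>n. ?D n x h)"
    proof (rule CauchyI)
      fix e :: real assume "e > 0"
      \<comment> \<open>The \<open>+ 1\<close> avoids division by zero when \<open>h = 0\<close>.\<close>
      define e' where "e' = e / (norm h + 1)"
      have e': "e' > 0"
        using \<open>e > 0\<close> unfolding e'_def by (intro divide_pos_pos) (auto intro: add_nonneg_pos)
      have "e' * norm h < e' * (norm h + 1)"
        using e' by simp
      also have "\<dots> = e"
        unfolding e'_def using norm_ge_zero[of h] by (simp add: add_nonneg_eq_0_iff)
      finally have "e' * norm h < e" .
      then show "\<exists>M. \<forall>m\<ge>M. \<forall>n\<ge>M. norm (?D m x h - ?D n x h) < e"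
        using Cauchy_D[OF e'] \<open>x \<in> B\<close> by (meson le_less_trans)
    qed
    then show ?thesis
      unfolding D_def by (simp add: Cauchy_convergent_iff convergent_LIMSEQ_iff)
  qed
  have D_unif: "\<forall>\<^sub>F n in sequentially. \<forall>x\<in>B. \<forall>h. norm (?D n x h - D x h) \<le> e * norm h" if "e > 0" for e
  proof -
    obtain N where N: "\<And>n m x h. n \<ge> N \<Longrightarrow> m \<ge> N \<Longrightarrow> x \<in> B \<Longrightarrow> norm (?D n x h - ?D m x h) \<le> e * norm h"
      using Cauchy_D[OF \<open>e > 0\<close>] by metis
    have "norm (?D n x h - D x h) \<le> e * norm h" if "n \<ge> N" "x \<in> B" for n x h
    proof (rule tendsto_upperbound)
      show "(\<lambda>m. norm (?D n x h - ?D m x h)) \<longlonglongrightarrow> norm (?D n x h - D x h)"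
        by (intro tendsto_intros D that)
      show "\<forall>\<^sub>F m in sequentially. norm (?D n x h - ?D m x h) \<le> e * norm h"
        using N that eventually_sequentially by blast
    qed simp
    then show ?thesis
      unfolding eventually_sequentially by blast
  qed
  have z: "z \<in> B" "open B" "convex B"
    by (simp_all add: B_def)
  have pw: "(\<lambda>n. f n x) \<longlonglongrightarrow> g x" for x
    using tendsto_uniform_limitI[OF lim, of x "norm x"] by simp
  have "\<exists>g'. \<forall>x\<in>B. (\<lambda>n. f n x) \<longlonglongrightarrow> g' x \<and> (g' has_derivative D x) (at x within B)"
  proof (rule has_derivative_sequence[OF z(3) _ D_unif z(1) pw])
    show "(f n has_derivative ?D n x) (at x within B)" for n x
      by (rule has_derivative_at_withinI[OF entire_has_derivative[OF f]])
  qed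
  then obtain g' where g': "\<And>x. x \<in> B \<Longrightarrow> (\<lambda>n. f n x) \<longlonglongrightarrow> g' x"
      "\<And>x. x \<in> B \<Longrightarrow> (g' has_derivative D x) (at x within B)"
    by blast
  have "(g' has_derivative D z) (at z)"
    using g'(2)[of z] z at_within_open by metis
  then have "(g has_derivative D z) (at z)"
    by (rule has_derivative_transform_within_open[OF _ z(2,1)])
       (use g'(1) pw LIMSEQ_unique in blast)
  moreover have "D z (c *s v) = c * D z v" for c v
  proof (rule LIMSEQ_unique[OF D[OF z(1)]])
    show "(\<lambda>n. ?D n z (c *s v)) \<longlonglongrightarrow> c * D z v"
      using tendsto_mult_left[OF D[OF z(1)]] by (simp add: entire_frechet_derivative_scale f)
  qed
  ultimately show "\<exists>D. (g has_derivative D) (at z) \<and> (\<forall>c v. D (c *s v) = c * D v)"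
    by blast
qed

section \<open>Montel's theorem\<close>

text \<open>
  Montel's theorem in \<open>d\<close> variables: local bounds give local Lipschitz bounds, so the Arzela-Ascoli
  theorem applies on every ball of integer radius, and a diagonal sequence serves all balls at once.
\<close>

lemma entire_Montel:
  fixes f :: "nat \<Rightarrow> complex ^ 'd \<Rightarrow> complex"
  assumes f: "\<And>n. entire (f n)"
    and bdd: "\<And>R. \<exists>M. \<forall>n z. norm z \<le> R \<longrightarrow> norm (f n z) \<le> M"
  obtains g k where "entire g" "strict_mono k"
    "\<And>R. uniform_limit (cball 0 R) (\<lambda>n. f (k n)) g sequentially"
proof -
  let ?P = "\<lambda>i r. \<exists>g. uniform_limit (cball 0 (real i)) (\<lambda>n. f (r n)) g sequentially"
  obtain k :: "nat \<Rightarrow> nat" where k: "strict_mono k" "\<And>i. ?P i (id \<circ> k)"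
  proof (rule subsequence_diagonalization_lemma[of ?P id])
    fix i :: nat and r :: "nat \<Rightarrow> nat"
    obtain M where M: "\<And>n z. norm z \<le> real i + 1 \<Longrightarrow> norm (f n z) \<le> M"
      using bdd by blast
    have "M \<ge> 0"
      using M[of 0 0] norm_ge_zero[of "f 0 0"] by (simp del: norm_ge_zero)
    obtain g k where gk: "strict_mono (k :: nat \<Rightarrow> nat)"
      "\<And>e. 0 < e \<Longrightarrow> \<exists>N. \<forall>n x. n \<ge> N \<and> x \<in> cball 0 (real i) \<longrightarrow> norm (f (r (k n)) x - g x) < e"
    proof (rule Arzela_Ascoli[of "cball 0 (real i)" "\<lambda>n. f (r n)" M])
      show "norm (f (r n) x) \<le> M" if "x \<in> cball 0 (real i)" for n x
        using that by (intro M) auto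
      fix x :: "complex ^ 'd" and e :: real
      assume x: "x \<in> cball 0 (real i)" and "0 < e"
      have "norm (f (r n) x - f (r n) y) < e"
        if y: "y \<in> cball 0 (real i)" "norm (x - y) < e / (M + 1)" for n y
      proof -
        have "norm (f (r n) x - f (r n) y) \<le> M * norm (x - y)"
          using x y by (intro entire_Lipschitz[OF f M]) auto
        also have "\<dots> \<le> (M + 1) * norm (x - y)"
          by (intro mult_right_mono) auto
        also have "\<dots> < e"
          using y \<open>M \<ge> 0\<close> by (simp add: field_simps)
        finally show ?thesis .
      qed
      then show "\<exists>d. 0 < d \<and> (\<forall>n y. y \<in> cball 0 (real i) \<and> norm (x - y) < d
          \<longrightarrow> norm (f (r n) x - f (r n) y) < e)"
        using \<open>0 < e\<close> \<open>M \<ge> 0\<close> by (intro exI[of _ "e / (M + 1)"]) auto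
    qed auto
    then have "?P i (r \<circ> k)"
      unfolding uniform_limit_iff eventually_sequentially dist_norm comp_apply by blast
    with gk(1) show "\<exists>k. strict_mono k \<and> ?P i (r \<circ> k)"
      by blast
  next
    fix i N :: nat and r k1 k2 :: "nat \<Rightarrow> nat"
    assume "?P i (r \<circ> k1)" and sub: "\<And>j. N \<le> j \<Longrightarrow> \<exists>j'\<ge>j. k2 j = k1 j'"
    then obtain g where g: "uniform_limit (cball 0 (real i)) (\<lambda>n. f ((r \<circ> k1) n)) g sequentially"
      by blast
    have "uniform_limit (cball 0 (real i)) (\<lambda>n. f ((r \<circ> k2) n)) g sequentially"
      unfolding uniform_limit_iff eventually_sequentially
    proof (intro allI impI)
      fix e :: real assume "e > 0"
      then obtain N' where N': "\<And>n. n \<ge> N' \<Longrightarrow> \<forall>x\<in>cball 0 (real i). dist (f ((r \<circ> k1) n) x) (g x) < e"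
        using g unfolding uniform_limit_iff eventually_sequentially by blast
      have "\<forall>x\<in>cball 0 (real i). dist (f ((r \<circ> k2) n) x) (g x) < e" if "n \<ge> max N N'" for n
        using sub[of n] N' that by (metis comp_apply le_trans max.bounded_iff)
      then show "\<exists>N. \<forall>n\<ge>N. \<forall>x\<in>cball 0 (real i). dist (f ((r \<circ> k2) n) x) (g x) < e"
        by blast
    qed
    then show "?P i (r \<circ> k2)"
      by blast
  qed auto
  define g where "g z = lim (\<lambda>n. f (k n) z)" for z
  have unif: "uniform_limit (cball 0 R) (\<lambda>n. f (k n)) g sequentially" for R
  proof -
    obtain i where i: "R \<le> real i"
      using real_arch_simple by blast
    obtain h where h: "uniform_limit (cball 0 (real i)) (\<lambda>n. f (k n)) h sequentially"
      using k(2)[of i] by auto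
    have "h z = g z" if "z \<in> cball 0 (real i)" for z
      unfolding g_def using tendsto_uniform_limitI[OF h that] by (metis limI)
    then have "uniform_limit (cball 0 (real i)) (\<lambda>n. f (k n)) g sequentially"
      using h by (auto simp: uniform_limit_iff)
    then show ?thesis
      by (rule uniform_limit_on_subset) (use i in auto)
  qed
  show thesis
    by (rule that[OF entire_uniform_limit[OF f unif] k(1) unif])
qed

section \<open>Integrals of the weighted density\<close>

lemma fock_space_entire: "F \<in> fock_space p \<Longrightarrow> entire F"
  by (simp add: fock_space_def)

lemma fock_space_set_integrable:
  assumes "F \<in> fock_space p" "A \<in> sets borel"
  shows "set_integrable lborel A (fock_density p F)"
  unfolding set_integrable_def
  using assms by (intro integrable_mult_indicator) (auto simp: fock_space_def)

lemma set_integral_fock_density_nonneg: "0 \<le> (LINT z:A|lborel. fock_density p F z)"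
  unfolding set_lebesgue_integral_def
  by (intro integral_nonneg_AE) (simp add: fock_density_nonneg)

lemma fock_norm_on_le_iff:
  assumes "1 \<le> p" "0 \<le> c"
  shows "fock_norm_on p A F \<le> c \<longleftrightarrow> (LINT z:A|lborel. fock_density p F z) \<le> c powr p"
proof -
  let ?I = "LINT z:A|lborel. fock_density p F z"
  have "fock_norm_on p A F powr p = ?I" "(c powr p) powr (1 / p) = c"
    using assms set_integral_fock_density_nonneg[of A p F]
    by (simp_all add: fock_norm_on_def powr_powr)
  then show ?thesis
    using assms powr_mono2[of p "fock_norm_on p A F" c] powr_mono2[of "1 / p" ?I "c powr p"]
      set_integral_fock_density_nonneg[of A p F]
    by (auto simp: fock_norm_on_def)
qed

lemma set_integral_fock_density_mono:
  assumes "F \<in> fock_space p" "A \<in> sets borel" "B \<in> sets borel" "A \<subseteq> B"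
  shows "(LINT z:A|lborel. fock_density p F z) \<le> (LINT z:B|lborel. fock_density p F z)"
  using assms fock_space_set_integrable[of F p]
  unfolding set_lebesgue_integral_def set_integrable_def
  by (intro integral_mono) (auto simp: fock_density_nonneg indicator_def)

text \<open>
  Estimates on tails and on differences only need to be correct up to a constant depending on \<open>p\<close>, so
  this crude substitute for Minkowski's inequality suffices.  It holds at every
  point, so it integrates over any measurable set.
\<close>

lemma fock_density_quasi_triangle:
  assumes p: "1 \<le> p" and le: "norm (F z) \<le> norm (G z) + norm (H z)"
  shows "fock_density p F z \<le> 2 powr p * (fock_density p G z + fock_density p H z)"
proof -
  let ?x = "norm (G z)" and ?y = "norm (H z)"
  have "norm (F z) powr p \<le> (2 * max ?x ?y) powr p"
    using p le by (intro powr_mono2) auto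
  also have "\<dots> = 2 powr p * max ?x ?y powr p"
    by (simp add: powr_mult)
  also have "\<dots> \<le> 2 powr p * (?x powr p + ?y powr p)"
    by (intro mult_left_mono) (auto simp: max_def)
  finally have "norm (F z) powr p * exp (- (pi / 2) * p * (norm z)\<^sup>2)
      \<le> 2 powr p * (?x powr p + ?y powr p) * exp (- (pi / 2) * p * (norm z)\<^sup>2)"
    by (rule mult_right_mono) simp
  then show ?thesis
    by (simp add: fock_density_def algebra_simps)
qed

lemma set_integral_fock_density_quasi_triangle:
  assumes p: "1 \<le> p" and A: "A \<in> sets borel"
    and mem: "F \<in> fock_space p" "G \<in> fock_space p" "H \<in> fock_space p"
    and le: "\<And>z. norm (F z) \<le> norm (G z) + norm (H z)"
  shows "(LINT z:A|lborel. fock_density p F z)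
    \<le> 2 powr p * ((LINT z:A|lborel. fock_density p G z) + (LINT z:A|lborel. fock_density p H z))"
proof -
  note int = fock_space_set_integrable[OF _ A]
  have dens: "fock_density p F z \<le> 2 powr p * (fock_density p G z + fock_density p H z)" for z
    by (rule fock_density_quasi_triangle[OF p le])
  have "(LINT z:A|lborel. fock_density p F z)
      \<le> (LINT z:A|lborel. 2 powr p * (fock_density p G z + fock_density p H z))"
    using int[OF mem(1)] int[OF mem(2)] int[OF mem(3)] dens
    by (intro set_integral_mono) auto
  also have "\<dots> = 2 powr p * ((LINT z:A|lborel. fock_density p G z) + (LINT z:A|lborel. fock_density p H z))"
    using int[OF mem(2)] int[OF mem(3)] by (simp add: set_integral_add)
  finally show ?thesis .
qed

lemma nn_set_integral_fock_density:
  assumes "F \<in> fock_space p" "A \<in> sets borel"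
  shows "(\<integral>\<^sup>+z. ennreal (fock_density p F z) * indicator A z \<partial>lborel)
    = ennreal (LINT z:A|lborel. fock_density p F z)"
proof -
  have "(\<integral>\<^sup>+z. ennreal (fock_density p F z) * indicator A z \<partial>lborel)
      = (\<integral>\<^sup>+z. ennreal (indicator A z *\<^sub>R fock_density p F z) \<partial>lborel)"
    by (intro nn_integral_cong) (auto simp: indicator_def)
  also have "\<dots> = ennreal (LINT z:A|lborel. fock_density p F z)"
    using fock_space_set_integrable[OF assms]
    unfolding set_lebesgue_integral_def set_integrable_def
    by (intro nn_integral_eq_integral) (auto simp: fock_density_nonneg)
  finally show ?thesis .
qed

section \<open>From norm bounds to pointwise bounds\<close>

text \<open>
  Norm boundedness controls values locally.  From \<open>t \<le> 1 + t powr p\<close> the mean value inequality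
  bounds \<open>\<bar>F z\<bar>\<close> by one plus an average of \<open>\<bar>F\<bar> powr p\<close>, and on the unit ball around \<open>z\<close> the
  Gaussian weight is bounded below.  The estimate is not homogeneous in \<open>F\<close>, but it is uniform over
  bounded families, which is what Montel's theorem asks for.
\<close>

lemma fock_space_pointwise_bound:
  fixes F :: "complex ^ 'd \<Rightarrow> complex"
  assumes p: "1 \<le> p" and F: "F \<in> fock_space p"
    and K: "(LINT z|lborel. fock_density p F z) \<le> K" and z: "norm z \<le> R"
  shows "norm (F z) \<le> 1 + exp (pi / 2 * p * (R + 1)\<^sup>2) * K / measure lborel (ball (0 :: complex ^ 'd) 1)"
proof -
  define \<beta> where "\<beta> = measure lborel (ball (0 :: complex ^ 'd) 1)"
  let ?E = "exp (pi / 2 * p * (R + 1)\<^sup>2)"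
  have em: "emeasure lborel (ball w 1) = ennreal \<beta>" for w :: "complex ^ 'd"
  proof -
    have "emeasure lborel (ball w 1) = ennreal (measure lborel (ball w 1))"
      using emeasure_lborel_ball_finite[of w 1] by (simp add: emeasure_eq_ennreal_measure less_top)
    moreover have "measure lborel (ball w 1) = \<beta>"
      unfolding \<beta>_def using measure_translation[of w "ball 0 1"] by (simp add: ball_translation)
    ultimately show ?thesis by simp
  qed
  have "\<beta> > 0"
    unfolding \<beta>_def by (rule content_ball_pos) simp
  have nn: "(\<integral>\<^sup>+w. ennreal (fock_density p F w) \<partial>lborel) = ennreal (LINT w|lborel. fock_density p F w)"
    using F by (intro nn_integral_eq_integral) (auto simp: fock_space_def fock_density_nonneg)
  have "0 \<le> (LINT w|lborel. fock_density p F w)"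
    by (intro integral_nonneg_AE) (simp add: fock_density_nonneg)
  then have "K \<ge> 0"
    using K by simp
  have [measurable]: "ball z 1 \<in> sets borel"
    by simp
  have [measurable]: "fock_density p F \<in> borel_measurable borel"
    using fock_density_measurable[OF fock_space_entire[OF F]] by simp
  have local: "norm (F w) \<le> 1 + ?E * fock_density p F w" if "w \<in> ball z 1" for w
  proof -
    have "norm w \<le> R + 1"
      using that z norm_triangle_sub[of w z] by (simp add: dist_norm norm_minus_commute)
    then have "pi / 2 * p * (norm w)\<^sup>2 \<le> pi / 2 * p * (R + 1)\<^sup>2"
      using p by (intro mult_left_mono power_mono) auto
    then have *: "1 \<le> ?E * exp (- (pi / 2) * p * (norm w)\<^sup>2)"
      by (simp flip: exp_add)
    have "norm (F w) \<le> 1 + norm (F w) powr p"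
    proof (cases "norm (F w) \<le> 1")
      case False
      then show ?thesis
        using powr_mono[OF p, of "norm (F w)"] by simp
    qed (simp add: add_increasing2)
    also have "norm (F w) powr p \<le> norm (F w) powr p * (?E * exp (- (pi / 2) * p * (norm w)\<^sup>2))"
      using mult_left_mono[OF *, of "norm (F w) powr p"] by simp
    finally show ?thesis
      by (simp add: fock_density_def mult_ac)
  qed
  have "ennreal (norm (F z) * \<beta>) = ennreal (norm (F z)) * emeasure lborel (ball (0 :: complex ^ 'd) 1)"
    using \<open>\<beta> > 0\<close> by (simp add: em ennreal_mult)
  also have "\<dots> \<le> (\<integral>\<^sup>+w. ennreal (norm (F w)) * indicator (ball z 1) w \<partial>lborel)"
    by (rule entire_norm_le_ball_mean[OF fock_space_entire[OF F]])
  also have "\<dots> \<le> (\<integral>\<^sup>+w. indicator (ball z 1) w + ennreal ?E * ennreal (fock_density p F w) \<partial>lborel)"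
  proof (rule nn_integral_mono)
    fix w
    show "ennreal (norm (F w)) * indicator (ball z 1) w
        \<le> indicator (ball z 1) w + ennreal ?E * ennreal (fock_density p F w)"
    proof (cases "w \<in> ball z 1")
      case True
      then have "ennreal (norm (F w)) \<le> ennreal (1 + ?E * fock_density p F w)"
        by (intro ennreal_leI local)
      also have "\<dots> = 1 + ennreal ?E * ennreal (fock_density p F w)"
        by (simp add: ennreal_plus ennreal_mult fock_density_nonneg)
      finally show ?thesis
        using True by simp
    qed simp
  qed
  also have "\<dots> = ennreal \<beta> + ennreal ?E * ennreal (LINT w|lborel. fock_density p F w)"
    by (subst nn_integral_add) (auto simp: nn_integral_cmult nn em)
  also have "\<dots> \<le> ennreal \<beta> + ennreal ?E * ennreal K"
    by (intro add_mono mult_left_mono ennreal_leI K) auto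
  also have "\<dots> = ennreal (\<beta> + ?E * K)"
    using \<open>\<beta> > 0\<close> \<open>K \<ge> 0\<close> by (simp add: ennreal_plus ennreal_mult)
  finally have "norm (F z) * \<beta> \<le> \<beta> + ?E * K"
    using \<open>\<beta> > 0\<close> \<open>K \<ge> 0\<close> by (subst (asm) ennreal_le_iff) auto
  then show ?thesis
    using \<open>\<beta> > 0\<close> unfolding \<beta>_def[symmetric] by (simp add: field_simps)
qed

lemma zero_in_fock_space:
  assumes "1 \<le> p"
  shows "(\<lambda>_ :: complex ^ 'd. 0) \<in> fock_space p"
proof -
  have "fock_density p (\<lambda>_ :: complex ^ 'd. 0) = (\<lambda>_. 0)"
    using assms by (auto simp: fock_density_def)
  moreover have "entire (\<lambda>_ :: complex ^ 'd. 0)"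
    unfolding entire_def by (auto intro!: exI[of _ "\<lambda>_. 0"])
  ultimately show ?thesis
    by (simp add: fock_space_def)
qed

text \<open>
  A metrically bounded set lies in a ball around some member of the space; the triangle inequality
  with the zero function recentres that ball at the origin.
\<close>

lemma fock_mbounded_integral_le:
  fixes S :: "(complex ^ 'd \<Rightarrow> complex) set"
  assumes p: "1 \<le> p" and S: "Metric_space.mbounded (fock_space p) (fock_dist p) S"
  shows "\<exists>K. \<forall>F\<in>S. (LINT z|lborel. fock_density p F z) \<le> K"
proof -
  interpret Metric_space "fock_space p :: (complex ^ 'd \<Rightarrow> complex) set" "fock_dist p"
    by (rule Metric_space_fock[OF p])
  obtain G B where GB: "S \<subseteq> mcball G B"
    using S unfolding mbounded_def by blast
  define C where "C = B + fock_dist p G (\<lambda>_. 0)"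
  have "(LINT z|lborel. fock_density p F z) \<le> C powr p" if "F \<in> S" for F
  proof -
    have F: "F \<in> fock_space p" "G \<in> fock_space p" "fock_dist p G F \<le> B"
      using GB that by (auto simp: in_mcball)
    have "fock_norm p F = fock_dist p F (\<lambda>_. 0)"
      by (simp add: fock_dist_def)
    also have "\<dots> \<le> C"
      using triangle[OF F(1,2) zero_in_fock_space[OF p]] F(3) by (simp add: C_def commute)
    finally have "fock_norm p F \<le> C" .
    moreover have "0 \<le> fock_norm p F"
      by (simp add: fock_norm_eq)
    ultimately show ?thesis
      using fock_norm_on_le_iff[OF p, of C UNIV F] by (simp add: set_lebesgue_integral_def)
  qed
  then show ?thesis
    by blast
qed

section \<open>Convergence in the Fock space\<close>

text \<open>
  Stated with the nonnegative integral, so that taking \<open>A\<close> to be the whole space proves integrability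
  of the limit, while taking the complement of a compact set passes tightness on to it.
\<close>

lemma fock_Fatou:
  assumes p: "1 \<le> p" and f: "\<And>n. f n \<in> fock_space p" and g: "entire g"
    and lim: "\<And>z. (\<lambda>n. f n z) \<longlonglongrightarrow> g z" and A: "A \<in> sets borel"
    and c: "\<And>n. (LINT z:A|lborel. fock_density p (f n) z) \<le> c"
  shows "(\<integral>\<^sup>+z. ennreal (fock_density p g z) * indicator A z \<partial>lborel) \<le> ennreal c"
proof -
  have dens: "(\<lambda>n. fock_density p (f n) z) \<longlonglongrightarrow> fock_density p g z" for z
    unfolding fock_density_def using p
    by (intro tendsto_mult tendsto_const tendsto_powr' tendsto_norm lim) auto
  note [measurable] = A
  have [measurable]: "fock_density p (f n) \<in> borel_measurable borel" for n
    using fock_density_measurable[OF fock_space_entire[OF f]] by simp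
  have "(\<integral>\<^sup>+z. ennreal (fock_density p g z) * indicator A z \<partial>lborel)
      = (\<integral>\<^sup>+z. liminf (\<lambda>n. ennreal (fock_density p (f n) z) * indicator A z) \<partial>lborel)"
  proof (rule nn_integral_cong)
    fix z
    have "(\<lambda>n. ennreal (fock_density p (f n) z) * indicator A z)
        \<longlonglongrightarrow> ennreal (fock_density p g z) * indicator A z"
      using tendsto_ennrealI[OF dens[of z]] by (cases "z \<in> A") auto
    then show "ennreal (fock_density p g z) * indicator A z
        = liminf (\<lambda>n. ennreal (fock_density p (f n) z) * indicator A z)"
      by (simp add: lim_imp_Liminf)
  qed
  also have "\<dots> \<le> liminf (\<lambda>n. \<integral>\<^sup>+z. ennreal (fock_density p (f n) z) * indicator A z \<partial>lborel)"
    by (intro nn_integral_liminf) measurable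
  also have "\<dots> \<le> liminf (\<lambda>n::nat. ennreal c)"
    using c by (intro Liminf_mono always_eventually allI)
      (simp add: nn_set_integral_fock_density[OF f A] ennreal_leI)
  also have "\<dots> = ennreal c"
    by (rule Liminf_const) simp
  finally show ?thesis .
qed

lemma fock_space_limit:
  fixes f :: "nat \<Rightarrow> complex ^ 'd \<Rightarrow> complex"
  assumes p: "1 \<le> p" and f: "\<And>n. f n \<in> fock_space p" and g: "entire g"
    and lim: "\<And>z. (\<lambda>n. f n z) \<longlonglongrightarrow> g z"
    and K: "\<And>n. (LINT z|lborel. fock_density p (f n) z) \<le> K"
  shows "g \<in> fock_space p"
proof -
  have "(\<integral>\<^sup>+z. ennreal (fock_density p g z) \<partial>lborel) \<le> ennreal K"
    using fock_Fatou[OF p f g lim, of UNIV K] K by (simp add: set_lebesgue_integral_def)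
  also have "\<dots> < \<infinity>"
    by simp
  finally have "integrable lborel (fock_density p g)"
    using fock_density_measurable[OF g] by (intro integrableI_nonneg) (auto simp: fock_density_nonneg)
  then show ?thesis
    using g by (simp add: fock_space_def)
qed

text \<open>
  Outside a compact \<open>U\<close> both \<open>f n\<close> and, by Fatou's lemma, the limit \<open>g\<close> carry little mass; on \<open>U\<close> the
  convergence is uniform and the volume is finite.
\<close>

lemma fock_converges_of_tight:
  fixes f :: "nat \<Rightarrow> complex ^ 'd \<Rightarrow> complex"
  assumes p: "1 \<le> p" and f: "\<And>n. f n \<in> fock_space p" and g: "g \<in> fock_space p"
    and unif: "\<And>R. uniform_limit (cball 0 R) f g sequentially"
    and tight: "\<And>e. e > 0 \<Longrightarrow> \<exists>U. compact U \<and> (\<forall>n. (LINT z:-U|lborel. fock_density p (f n) z) \<le> e)"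
  shows "(\<lambda>n. fock_dist p (f n) g) \<longlonglongrightarrow> 0"
proof -
  let ?h = "\<lambda>n z. f n z - g z"
  have h: "?h n \<in> fock_space p" for n
    by (rule fock_space_diff[OF p f g])
  have lim: "(\<lambda>n. f n z) \<longlonglongrightarrow> g z" for z
    using tendsto_uniform_limitI[OF unif, of z "norm z"] by simp
  have "(\<lambda>n. LINT z|lborel. fock_density p (?h n) z) \<longlonglongrightarrow> 0"
  proof (rule LIMSEQ_I)
    fix e :: real assume "e > 0"
    \<comment> \<open>Chosen so that the quasi-triangle inequality turns two tails of size \<open>e'\<close> into \<open>e / 4\<close>.\<close>
    define e' where "e' = e / (2 powr p * 8)"
    have e': "e' > 0" "2 powr p * (e' + e') = e / 4"
      using \<open>e > 0\<close> by (simp_all add: e'_def)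
    obtain U where U: "compact U" "\<And>n. (LINT z:-U|lborel. fock_density p (f n) z) \<le> e'"
      using tight[OF e'(1)] by blast
    have sets: "U \<in> sets borel" "- U \<in> sets borel"
      using U(1) by (simp_all add: borel_compact borel_comp)
    have "(LINT z:-U|lborel. fock_density p g z) \<le> e'"
      using fock_Fatou[OF p f fock_space_entire[OF g] lim sets(2) U(2)] e'
      by (simp add: nn_set_integral_fock_density[OF g sets(2)])
    then have g_tail: "(LINT z:-U|lborel. fock_density p g z) \<le> e'" .
    have tail: "(LINT z:-U|lborel. fock_density p (?h n) z) \<le> e / 4" for n
    proof -
      have "(LINT z:-U|lborel. fock_density p (?h n) z)
          \<le> 2 powr p * ((LINT z:-U|lborel. fock_density p (f n) z) + (LINT z:-U|lborel. fock_density p g z))"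
        by (intro set_integral_fock_density_quasi_triangle p sets h f g norm_triangle_ineq4)
      also have "\<dots> \<le> 2 powr p * (e' + e')"
        by (intro mult_left_mono add_mono U(2) g_tail) simp
      finally show ?thesis
        by (simp only: e'(2))
    qed
    define m where "m = measure lborel U"
    \<comment> \<open>The \<open>+ 1\<close> avoids division by zero when \<open>U\<close> is a null set.\<close>
    define c where "c = e / (4 * (m + 1))"
    have "m \<ge> 0"
      by (simp add: m_def)
    then have c: "c > 0" "c * m \<le> e / 4"
      using \<open>e > 0\<close> by (simp_all add: c_def field_simps)
    obtain R where R: "U \<subseteq> cball 0 R"
      using compact_imp_bounded[OF U(1)] unfolding bounded_iff subset_iff mem_cball_0 by metis
    have "\<forall>\<^sub>F n in sequentially. \<forall>z\<in>cball 0 R. dist (f n z) (g z) < c powr (1 / p)"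
      using unif[of R] c by (auto simp: uniform_limit_iff simp del: mem_cball_0)
    then obtain N where N: "\<And>n z. n \<ge> N \<Longrightarrow> z \<in> U \<Longrightarrow> norm (?h n z) < c powr (1 / p)"
      using R unfolding eventually_sequentially dist_norm by blast
    have "norm ((LINT z|lborel. fock_density p (?h n) z) - 0) < e" if "n \<ge> N" for n
    proof -
      have "fock_density p (?h n) z \<le> c" if "z \<in> U" for z
      proof -
        have "norm (?h n z) powr p \<le> (c powr (1 / p)) powr p"
          using N[OF \<open>n \<ge> N\<close> that] p by (intro powr_mono2) auto
        also have "\<dots> = c"
          using p c by (simp add: powr_powr)
        finally have "norm (?h n z) powr p * exp (- (pi / 2) * p * (norm z)\<^sup>2) \<le> c * 1"
          using p c by (intro mult_mono) auto
        then show ?thesis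
          by (simp add: fock_density_def)
      qed
      then have "(LINT z:U|lborel. fock_density p (?h n) z) \<le> (LINT z:U|lborel. c)"
        using fock_space_set_integrable[OF h sets(1)] emeasure_compact_finite[OF U(1)] sets
        by (intro set_integral_mono) (auto simp: set_integrable_def)
      also have "\<dots> = c * m"
        using sets emeasure_compact_finite[OF U(1)]
        by (simp add: m_def set_lebesgue_integral_def)
      also note c(2)
      finally have core: "(LINT z:U|lborel. fock_density p (?h n) z) \<le> e / 4" .
      have "(LINT z|lborel. fock_density p (?h n) z)
          = (LINT z:U \<union> -U|lborel. fock_density p (?h n) z)"
        by (simp add: set_lebesgue_integral_def)
      also have "\<dots> = (LINT z:U|lborel. fock_density p (?h n) z) + (LINT z:-U|lborel. fock_density p (?h n) z)"
        using sets by (intro set_integral_Un fock_space_set_integrable h) auto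
      also have "\<dots> < e"
        using core tail[of n] \<open>e > 0\<close> by simp
      finally show ?thesis
        using set_integral_fock_density_nonneg[of UNIV p "?h n"]
        by (simp add: set_lebesgue_integral_def)
    qed
    then show "\<exists>N. \<forall>n\<ge>N. norm ((LINT z|lborel. fock_density p (?h n) z) - 0) < e"
      by blast
  qed
  then have "(\<lambda>n. (LINT z|lborel. fock_density p (?h n) z) powr (1 / p)) \<longlonglongrightarrow> 0 powr (1 / p)"
    using p set_integral_fock_density_nonneg[of UNIV p "?h n" for n]
    by (intro tendsto_powr' tendsto_const) (auto simp: set_lebesgue_integral_def intro!: always_eventually)
  then show ?thesis
    by (simp add: fock_dist_def fock_norm_eq)
qed

section \<open>Compactness and tightness\<close>

lemma fock_tail_tendsto_0:
  fixes F :: "complex ^ 'd \<Rightarrow> complex"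
  assumes F: "F \<in> fock_space p"
  shows "(\<lambda>n. LINT z:- cball 0 (real n)|lborel. fock_density p F z) \<longlonglongrightarrow> 0"
proof -
  have "(\<lambda>n. LINT z:- cball 0 (real n)|lborel. fock_density p F z) \<longlonglongrightarrow> (LINT z::complex ^ 'd|lborel. 0)"
    unfolding set_lebesgue_integral_def
  proof (rule integral_dominated_convergence[where w = "fock_density p F"])
    show "integrable lborel (fock_density p F)"
      using F by (simp add: fock_space_def)
    then show "(\<lambda>z. indicator (- cball 0 (real n)) z *\<^sub>R fock_density p F z) \<in> borel_measurable lborel" for n
      by (intro borel_measurable_scaleR borel_measurable_indicator) auto
    show "AE z in lborel. (\<lambda>n. indicator (- cball 0 (real n)) z *\<^sub>R fock_density p F z) \<longlonglongrightarrow> 0"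
    proof (rule AE_I2)
      fix z :: "complex ^ 'd"
      obtain N where "norm z \<le> real N"
        using real_arch_simple by blast
      then have "indicator (- cball 0 (real n)) z *\<^sub>R fock_density p F z = 0" if "n \<ge> N" for n
        using that by (simp add: indicator_def)
      then show "(\<lambda>n. indicator (- cball 0 (real n)) z *\<^sub>R fock_density p F z) \<longlonglongrightarrow> 0"
        by (intro tendsto_eventually) (auto simp: eventually_sequentially)
    qed
  qed (auto simp: fock_density_nonneg indicator_def)
  then show ?thesis
    by simp
qed

text \<open>
  A compact set lies within \<open>\<eta>\<close> of finitely many of its members.  Their tails vanish outside one common
  ball, and every other member differs from one of them by little in norm, hence also on the
  complement of that ball.
\<close>

lemma fock_compact_imp_tight:
  fixes S :: "(complex ^ 'd \<Rightarrow> complex) set"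
  assumes p: "1 \<le> p" and S: "compactin (fock_topology p) S" and "\<epsilon> > 0"
  obtains U :: "(complex ^ 'd) set" where "compact U" "\<And>F. F \<in> S \<Longrightarrow> fock_norm_on p (- U) F \<le> \<epsilon>"
proof -
  interpret Metric_space "fock_space p :: (complex ^ 'd \<Rightarrow> complex) set" "fock_dist p"
    by (rule Metric_space_fock[OF p])
  \<comment> \<open>With this choice \<open>2 powr p * (2 * \<eta> powr p) \<le> \<epsilon> powr p\<close>, because \<open>2 \<le> 2 powr p\<close>.\<close>
  define \<eta> where "\<eta> = \<epsilon> / 4"
  have "\<eta> > 0"
    using \<open>\<epsilon> > 0\<close> by (simp add: \<eta>_def)
  have "2 powr p * (\<eta> powr p + \<eta> powr p) = 2 * (2 powr p * \<eta> powr p)"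
    by simp
  also have "\<dots> \<le> 2 powr p * (2 powr p * \<eta> powr p)"
    using powr_mono[OF p, of 2] by (intro mult_right_mono) auto
  also have "\<dots> = \<epsilon> powr p"
    using \<open>\<epsilon> > 0\<close> by (simp add: \<eta>_def flip: powr_mult)
  finally have \<eta>: "2 powr p * (\<eta> powr p + \<eta> powr p) \<le> \<epsilon> powr p" .
  have "mtotally_bounded S"
    by (rule compactin_imp_mtotally_bounded[OF S])
  from this[unfolded mtotally_bounded_def, rule_format, OF \<open>\<eta> > 0\<close>]
  obtain T where T: "finite T" "T \<subseteq> S" "S \<subseteq> (\<Union>G\<in>T. mball G \<eta>)"
    by (elim exE conjE)
  have SM: "S \<subseteq> fock_space p"
    using compactin_subset_topspace[OF S] by simp
  have "\<forall>\<^sub>F n in sequentially. \<forall>G\<in>T. (LINT z:- cball 0 (real n)|lborel. fock_density p G z) < \<eta> powr p"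
  proof (intro eventually_ball_finite T(1) ballI)
    fix G assume "G \<in> T"
    then have "G \<in> fock_space p"
      using T SM by blast
    then show "\<forall>\<^sub>F n in sequentially. (LINT z:- cball 0 (real n)|lborel. fock_density p G z) < \<eta> powr p"
      using \<open>\<eta> > 0\<close> by (intro order_tendstoD(2)[OF fock_tail_tendsto_0]) auto
  qed
  then obtain n where n: "\<And>G. G \<in> T \<Longrightarrow> (LINT z:- cball 0 (real n)|lborel. fock_density p G z) < \<eta> powr p"
    by (auto simp: eventually_sequentially)
  let ?U = "cball (0 :: complex ^ 'd) (real n)"
  have sets: "- ?U \<in> sets borel"
    by (intro borel_open) (simp add: open_Compl)
  have "fock_norm_on p (- ?U) F \<le> \<epsilon>" if F: "F \<in> S" for F
  proof -
    obtain G where G: "G \<in> T" "F \<in> mball G \<eta>"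
      using T(3) F by blast
    then have mem: "F \<in> fock_space p" "G \<in> fock_space p"
      and near: "fock_norm p (\<lambda>z. F z - G z) < \<eta>"
      using commute by (auto simp: in_mball simp flip: fock_dist_def)
    have "(LINT z|lborel. fock_density p (\<lambda>z. F z - G z) z) \<le> \<eta> powr p"
      using fock_norm_on_le_iff[OF p, of \<eta> UNIV "\<lambda>z. F z - G z"] near \<open>\<eta> > 0\<close>
      by (simp add: set_lebesgue_integral_def)
    moreover have "(LINT z:- ?U|lborel. fock_density p (\<lambda>z. F z - G z) z)
        \<le> (LINT z|lborel. fock_density p (\<lambda>z. F z - G z) z)"
      using set_integral_fock_density_mono[OF fock_space_diff[OF p mem] sets, of UNIV]
      by (simp add: set_lebesgue_integral_def)
    ultimately have FG: "(LINT z:- ?U|lborel. fock_density p (\<lambda>z. F z - G z) z) \<le> \<eta> powr p"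
      by simp
    have "(LINT z:- ?U|lborel. fock_density p F z)
        \<le> 2 powr p * ((LINT z:- ?U|lborel. fock_density p (\<lambda>z. F z - G z) z)
            + (LINT z:- ?U|lborel. fock_density p G z))"
      using norm_triangle_ineq[of "F z - G z" "G z" for z]
      by (intro set_integral_fock_density_quasi_triangle p sets mem fock_space_diff) simp
    also have "\<dots> \<le> 2 powr p * (\<eta> powr p + \<eta> powr p)"
      using n[OF G(1)] by (intro mult_left_mono add_mono FG) auto
    finally have "(LINT z:- ?U|lborel. fock_density p F z) \<le> 2 powr p * (\<eta> powr p + \<eta> powr p)" .
    then show ?thesis
      using \<eta> fock_norm_on_le_iff[OF p, of \<epsilon> "- ?U" F] \<open>\<epsilon> > 0\<close> by simp
  qed
  then show thesis
    by (intro that[of ?U]) auto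
qed

text \<open>
  Sequential compactness: Montel's theorem extracts a locally uniform limit, Fatou's lemma places it
  in the Fock space, tightness upgrades the convergence to the norm, and closedness keeps the limit
  in \<open>S\<close>.
\<close>

lemma fock_tight_imp_compact:
  fixes S :: "(complex ^ 'd \<Rightarrow> complex) set"
  assumes p: "1 \<le> p" and clo: "closedin (fock_topology p) S"
    and bdd: "Metric_space.mbounded (fock_space p) (fock_dist p) S"
    and tight: "\<And>\<epsilon>. \<epsilon> > 0 \<Longrightarrow> \<exists>U :: (complex ^ 'd) set. compact U \<and> (\<forall>F\<in>S. fock_norm_on p (- U) F \<le> \<epsilon>)"
  shows "compactin (fock_topology p) S"
proof -
  interpret Metric_space "fock_space p :: (complex ^ 'd \<Rightarrow> complex) set" "fock_dist p"
    by (rule Metric_space_fock[OF p])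
  have SM: "S \<subseteq> fock_space p"
    using closedin_subset[OF clo] by simp
  obtain K where K: "\<And>F. F \<in> S \<Longrightarrow> (LINT z|lborel. fock_density p F z) \<le> K"
    using fock_mbounded_integral_le[OF p bdd] by metis
  have "\<exists>l r. l \<in> S \<and> strict_mono r \<and> limitin mtopology (\<sigma> \<circ> r) l sequentially"
    if \<sigma>: "range \<sigma> \<subseteq> S" for \<sigma> :: "nat \<Rightarrow> _"
  proof -
    have \<sigma>S: "\<sigma> n \<in> S" and \<sigma>M: "\<sigma> n \<in> fock_space p" for n
      using \<sigma> SM by auto
    have bdd: "\<exists>M. \<forall>n z. norm z \<le> R \<longrightarrow> norm (\<sigma> n z) \<le> M" for R
      using fock_space_pointwise_bound[OF p \<sigma>M K[OF \<sigma>S]] by blast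
    obtain g k where g: "entire g" and k: "strict_mono k"
      and unif: "\<And>R. uniform_limit (cball 0 R) (\<lambda>n. \<sigma> (k n)) g sequentially"
      by (rule entire_Montel[OF fock_space_entire[OF \<sigma>M] bdd], rule that)
    have "(\<lambda>n. \<sigma> (k n) z) \<longlonglongrightarrow> g z" for z
      using tendsto_uniform_limitI[OF unif, of z "norm z"] by simp
    then have gM: "g \<in> fock_space p"
      using fock_space_limit[OF p \<sigma>M g _ K[OF \<sigma>S]] by blast
    have "\<exists>U. compact U \<and> (\<forall>n. (LINT z:-U|lborel. fock_density p (\<sigma> (k n)) z) \<le> e)" if "e > 0" for e
    proof -
      obtain U where "compact U" "\<forall>F\<in>S. fock_norm_on p (- U) F \<le> e powr (1 / p)"
        using tight[of "e powr (1 / p)"] \<open>e > 0\<close> by auto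
      moreover have "(e powr (1 / p)) powr p = e"
        using \<open>e > 0\<close> p by (simp add: powr_powr)
      ultimately show ?thesis
        using fock_norm_on_le_iff[OF p, of "e powr (1 / p)" "- U"] \<sigma>S by auto
    qed
    then have "(\<lambda>n. fock_dist p (\<sigma> (k n)) g) \<longlonglongrightarrow> 0"
      by (intro fock_converges_of_tight[OF p \<sigma>M gM unif])
    then have "limitin mtopology (\<sigma> \<circ> k) g sequentially"
      using \<sigma>M gM by (simp add: limitin_metric_dist_null)
    moreover have "g \<in> S"
    proof -
      have "range (\<sigma> \<circ> k) \<subseteq> S"
        using \<sigma>S by auto
      then show ?thesis
        using clo calculation unfolding metric_closedin_iff_sequentially_closed by blast
    qed
    ultimately show ?thesis
      using k by blast
  qed
  then show ?thesis
    using SM unfolding compactin_sequentially by blast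
qed

theorem theorem7:
  fixes p :: real and S :: "(complex ^ 'd \<Rightarrow> complex) set"
  assumes "1 \<le> p"
    and "closedin (fock_topology p) S"
    and "Metric_space.mbounded (fock_space p) (fock_dist p) S"
  shows "compactin (fock_topology p) S \<longleftrightarrow>
    (\<forall>\<epsilon>::real. \<epsilon> > 0 \<longrightarrow>
      (\<exists>U :: (complex ^ 'd) set. compact U \<and>
        (SUP F\<in>S. ennreal (fock_norm_on p (- U) F)) < ennreal \<epsilon>))"
proof (intro iffI allI impI)
  fix \<epsilon> :: real
  assume "compactin (fock_topology p) S" "\<epsilon> > 0"
  then obtain U :: "(complex ^ 'd) set" where U: "compact U" "\<And>F. F \<in> S \<Longrightarrow> fock_norm_on p (- U) F \<le> \<epsilon> / 2"
    using fock_compact_imp_tight[OF assms(1), of S "\<epsilon> / 2"] by auto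
  have "(SUP F\<in>S. ennreal (fock_norm_on p (- U) F)) \<le> ennreal (\<epsilon> / 2)"
    by (intro SUP_least ennreal_leI U)
  also have "\<dots> < ennreal \<epsilon>"
    using \<open>\<epsilon> > 0\<close> by (simp add: ennreal_lessI)
  finally show "\<exists>U :: (complex ^ 'd) set. compact U \<and>
      (SUP F\<in>S. ennreal (fock_norm_on p (- U) F)) < ennreal \<epsilon>"
    using U(1) by blast
next
  assume tight: "\<forall>\<epsilon>::real. \<epsilon> > 0 \<longrightarrow> (\<exists>U :: (complex ^ 'd) set. compact U \<and>
      (SUP F\<in>S. ennreal (fock_norm_on p (- U) F)) < ennreal \<epsilon>)"
  show "compactin (fock_topology p) S"
  proof (rule fock_tight_imp_compact[OF assms])
    fix \<epsilon> :: real
    assume "\<epsilon> > 0"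
    then obtain U :: "(complex ^ 'd) set" where U: "compact U"
      "(SUP F\<in>S. ennreal (fock_norm_on p (- U) F)) < ennreal \<epsilon>"
      using tight by blast
    have "fock_norm_on p (- U) F \<le> \<epsilon>" if "F \<in> S" for F
    proof -
      have "ennreal (fock_norm_on p (- U) F) \<le> ennreal \<epsilon>"
        using SUP_upper[OF that, of "\<lambda>F. ennreal (fock_norm_on p (- U) F)"] U(2) by (meson le_less_trans less_imp_le)
      then show ?thesis
        using \<open>\<epsilon> > 0\<close> by (simp add: ennreal_le_iff)
    qed
    with U(1) show "\<exists>U :: (complex ^ 'd) set. compact U \<and> (\<forall>F\<in>S. fock_norm_on p (- U) F \<le> \<epsilon>)"
      by blast
  qed
qed

end
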